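(* Let $G$ and $H$ be groups of nilpotence class two. Then $\mathsf{Q}(G,H)$ is a normal subgroup of $\mathsf{Quad}(G,H)$ (with respect to pointwise addition of maps). In particular, any linear combination of homomorphisms $G\to H$ is a q-map.
   Context: Groups are written additively; $[a,b]=-a-b+a+b$. A group $G$ is of nilpotence class two (a nil$_2$-group) if $[[G,G],G]=0$; in particular abelian groups are allowed. $\mathsf Z(H)$ is the center of $H$. For a map $f:G\to H$ of groups put $(a\mid b)_f:=-(f(a)+f(b))+f(a+b)$ (the cross-effect). The map $f$ is weakly quadratic if for all $a,b,c\in G$ the element $(a\mid b)_f$ commutes with $f(c)$ and $(a\mid b)_f$ is linear (additive) in $a$ and in $b$. It is quadratic if it is weakly quadratic and $(a\mid b)_f\in\mathsf Z(H)$ for all $a,b\in G$. For nil$_2$-groups $G,H$, a weakly quadratic map $f:G\to H$ is a q-map if $(a\mid b)_f\in[H,H]$ for all $a,b\in G$. $\mathsf{Quad}(G,H)$ denotes the set of quadratic maps $G\to H$, which is a group under pointwise addition when $H$ is a nil$_2$-group, and $\mathsf Q(G,H)\subseteq\mathsf{Quad}(G,H)$ denotes the set of q-maps. *)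

theory Defs
  imports "HOL-Algebra.Algebra"
begin

text \<open>
  The groups are not assumed abelian and are written additively in the source; here they are
  HOL-Algebra groups, so \<open>a + b\<close>, \<open>- a\<close>, \<open>0\<close> and \<open>n a\<close> become \<open>a \<otimes> b\<close>, \<open>inv a\<close>, \<open>\<one>\<close> and \<open>a [^] n\<close>.
\<close>

definition commutator :: "('a, 'm) monoid_scheme \<Rightarrow> 'a \<Rightarrow> 'a \<Rightarrow> 'a"
  where "commutator G a b = inv\<^bsub>G\<^esub> a \<otimes>\<^bsub>G\<^esub> inv\<^bsub>G\<^esub> b \<otimes>\<^bsub>G\<^esub> a \<otimes>\<^bsub>G\<^esub> b"

definition commutator_subgroup :: "('a, 'm) monoid_scheme \<Rightarrow> 'a set \<Rightarrow> 'a set \<Rightarrow> 'a set"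
  where "commutator_subgroup G A B = generate G {commutator G a b | a b. a \<in> A \<and> b \<in> B}"

text \<open>
  The library's \<^const>\<open>derived\<close> is generated by the elements \<open>a \<otimes> b \<otimes> inv a \<otimes> inv b\<close>; on the
  whole group this gives the same subgroup.
\<close>

lemma (in group) commutator_subgroup_carrier:
  "commutator_subgroup G (carrier G) (carrier G) = derived G (carrier G)"
proof -
  have "{commutator G a b | a b. a \<in> carrier G \<and> b \<in> carrier G} = derived_set G (carrier G)"
    (is "?L = ?R")
  proof
    show "?L \<subseteq> ?R"
    proof
      fix x assume "x \<in> ?L"
      then obtain a b where "a \<in> carrier G" "b \<in> carrier G" "x = commutator G a b"
        by blast
      then have "x = inv a \<otimes> inv b \<otimes> inv (inv a) \<otimes> inv (inv b)"
        "inv a \<in> carrier G" "inv b \<in> carrier G"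
        by (simp_all add: commutator_def)
      then show "x \<in> ?R" by blast
    qed
    show "?R \<subseteq> ?L"
    proof
      fix x assume "x \<in> ?R"
      then obtain a b where "a \<in> carrier G" "b \<in> carrier G"
        "x = a \<otimes> b \<otimes> inv a \<otimes> inv b"
        by blast
      then have "x = commutator G (inv a) (inv b)" "inv a \<in> carrier G" "inv b \<in> carrier G"
        by (simp_all add: commutator_def)
      then show "x \<in> ?L" by blast
    qed
  qed
  then show ?thesis
    by (simp add: commutator_subgroup_def derived_def)
qed

definition nil2_group :: "('a, 'm) monoid_scheme \<Rightarrow> bool"
  where "nil2_group G \<longleftrightarrow>
    group G \<and> commutator_subgroup G (derived G (carrier G)) (carrier G) = {\<one>\<^bsub>G\<^esub>}"

definition group_center :: "('a, 'm) monoid_scheme \<Rightarrow> 'a set"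
  where "group_center H = {z \<in> carrier H. \<forall>h \<in> carrier H. z \<otimes>\<^bsub>H\<^esub> h = h \<otimes>\<^bsub>H\<^esub> z}"

definition cross_effect ::
    "('a, 'm) monoid_scheme \<Rightarrow> ('b, 'n) monoid_scheme \<Rightarrow> ('a \<Rightarrow> 'b) \<Rightarrow> 'a \<Rightarrow> 'a \<Rightarrow> 'b"
  where "cross_effect G H f a b = inv\<^bsub>H\<^esub> (f a \<otimes>\<^bsub>H\<^esub> f b) \<otimes>\<^bsub>H\<^esub> f (a \<otimes>\<^bsub>G\<^esub> b)"

definition weakly_quadratic ::
    "('a, 'm) monoid_scheme \<Rightarrow> ('b, 'n) monoid_scheme \<Rightarrow> ('a \<Rightarrow> 'b) \<Rightarrow> bool"
  where "weakly_quadratic G H f \<longleftrightarrow>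
    f \<in> carrier G \<rightarrow> carrier H \<and>
    (\<forall>a \<in> carrier G. \<forall>b \<in> carrier G. \<forall>c \<in> carrier G.
       cross_effect G H f a b \<otimes>\<^bsub>H\<^esub> f c = f c \<otimes>\<^bsub>H\<^esub> cross_effect G H f a b) \<and>
    (\<forall>b \<in> carrier G. (\<lambda>a. cross_effect G H f a b) \<in> hom G H) \<and>
    (\<forall>a \<in> carrier G. (\<lambda>b. cross_effect G H f a b) \<in> hom G H)"

definition quadratic ::
    "('a, 'm) monoid_scheme \<Rightarrow> ('b, 'n) monoid_scheme \<Rightarrow> ('a \<Rightarrow> 'b) \<Rightarrow> bool"
  where "quadratic G H f \<longleftrightarrow>
    weakly_quadratic G H f \<and>
    (\<forall>a \<in> carrier G. \<forall>b \<in> carrier G. cross_effect G H f a b \<in> group_center H)"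

definition q_map ::
    "('a, 'm) monoid_scheme \<Rightarrow> ('b, 'n) monoid_scheme \<Rightarrow> ('a \<Rightarrow> 'b) \<Rightarrow> bool"
  where "q_map G H f \<longleftrightarrow>
    weakly_quadratic G H f \<and>
    (\<forall>a \<in> carrier G. \<forall>b \<in> carrier G. cross_effect G H f a b \<in> derived H (carrier H))"

text \<open>
  Maps \<open>G \<rightarrow> H\<close> are represented by functions that are \<^const>\<open>undefined\<close> outside \<open>carrier G\<close>, so
  that two maps are equal iff they agree on \<open>carrier G\<close>.
\<close>

definition Q_maps ::
    "('a, 'm) monoid_scheme \<Rightarrow> ('b, 'n) monoid_scheme \<Rightarrow> ('a \<Rightarrow> 'b) set"
  where "Q_maps G H = {f \<in> carrier G \<rightarrow>\<^sub>E carrier H. q_map G H f}"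

definition Quad ::
    "('a, 'm) monoid_scheme \<Rightarrow> ('b, 'n) monoid_scheme \<Rightarrow> ('a \<Rightarrow> 'b) monoid"
  where "Quad G H =
    \<lparr>carrier = {f \<in> carrier G \<rightarrow>\<^sub>E carrier H. quadratic G H f},
     monoid.mult = (\<lambda>f g. \<lambda>x \<in> carrier G. f x \<otimes>\<^bsub>H\<^esub> g x),
     one = (\<lambda>x \<in> carrier G. \<one>\<^bsub>H\<^esub>)\<rparr>"

text \<open>
  The linear combination \<open>n\<^sub>1 f\<^sub>1 + \<dots> + n\<^sub>k f\<^sub>k\<close> with integer coefficients. As \<open>H\<close> need not be
  abelian, the order of the summands matters, hence a list.
\<close>

definition linear_combination ::
    "('a, 'm) monoid_scheme \<Rightarrow> ('b, 'n) monoid_scheme \<Rightarrow> (int \<times> ('a \<Rightarrow> 'b)) list \<Rightarrow> 'a \<Rightarrow> 'b"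
  where "linear_combination G H nfs =
    (\<lambda>x \<in> carrier G. foldr (\<lambda>(n, f) s. f x [^]\<^bsub>H\<^esub> n \<otimes>\<^bsub>H\<^esub> s) nfs \<one>\<^bsub>H\<^esub>)"

end

theory Submission
  imports Defs
begin

text \<open>
  Modulo the center of \<open>H\<close> a quadratic map is a homomorphism, and the commutator of a nil\<open>\<^sub>2\<close>-group
  is bilinear, central-valued and trivial on central elements. Hence the cross-effects of \<open>f + g\<close> and \<open>- f\<close>
  are \<open>(a | b)\<^sub>f + (a | b)\<^sub>g + [f b, g a]\<close> and \<open>- (a | b)\<^sub>f + [- f b, - f a]\<close>: they are again
  bilinear and central, and up to commutators they add up, so that they stay in \<open>[H, H]\<close> under
  sums, negatives and conjugation.
\<close>

section \<open>Central elements and the derived subgroup\<close>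

lemma nil2_group_derived_subset_center:
  assumes "nil2_group H"
  shows "derived H (carrier H) \<subseteq> group_center H"
proof
  interpret group H
    using assms by (simp add: nil2_group_def)
  fix d assume d: "d \<in> derived H (carrier H)"
  then have dc: "d \<in> carrier H"
    using derived_in_carrier by blast
  have "d \<otimes>\<^bsub>H\<^esub> h = h \<otimes>\<^bsub>H\<^esub> d" if h: "h \<in> carrier H" for h
  proof -
    have "commutator H d h \<in> commutator_subgroup H (derived H (carrier H)) (carrier H)"
      unfolding commutator_subgroup_def using d h by (blast intro: generate.incl)
    \<comment> \<open>The defining condition of \<open>nil2_group\<close> makes this commutator
      trivial, and regrouped it says that \<open>h \<otimes> d\<close> and
      \<open>d \<otimes> h\<close> have the same inverse.\<close>
    then have "inv\<^bsub>H\<^esub> (h \<otimes>\<^bsub>H\<^esub> d) \<otimes>\<^bsub>H\<^esub> (d \<otimes>\<^bsub>H\<^esub> h) = \<one>\<^bsub>H\<^esub>"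
      using assms d dc h by (simp add: nil2_group_def commutator_def inv_mult_group m_assoc)
    then have "inv\<^bsub>H\<^esub> (h \<otimes>\<^bsub>H\<^esub> d) = inv\<^bsub>H\<^esub> (d \<otimes>\<^bsub>H\<^esub> h)"
      using dc h by (intro inv_equality[symmetric]) auto
    then show ?thesis
      using dc h by (metis inv_inv m_closed)
  qed
  with dc show "d \<in> group_center H"
    by (simp add: group_center_def)
qed

lemma (in group) subgroup_group_center: "subgroup (group_center G) G"
proof (rule subgroupI)
  show "group_center G \<subseteq> carrier G" "group_center G \<noteq> {}"
    by (auto simp: group_center_def)
next
  fix z assume z: "z \<in> group_center G"
  have "inv z \<otimes> h = h \<otimes> inv z" if h: "h \<in> carrier G" for h
  proof -
    have zc: "z \<in> carrier G" and comm: "z \<otimes> inv h = inv h \<otimes> z"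
      using z inv_closed[OF h] unfolding group_center_def by blast+
    have "inv z \<otimes> h = inv (inv h \<otimes> z)"
      using zc h by (simp add: inv_mult_group)
    also have "\<dots> = h \<otimes> inv z"
      using zc h unfolding comm[symmetric] by (simp add: inv_mult_group)
    finally show ?thesis .
  qed
  with z show "inv z \<in> group_center G"
    unfolding group_center_def by blast
next
  fix y z assume y: "y \<in> group_center G" and z: "z \<in> group_center G"
  have yz: "y \<in> carrier G" "z \<in> carrier G"
    using y z unfolding group_center_def by blast+
  have "y \<otimes> z \<otimes> h = h \<otimes> (y \<otimes> z)" if h: "h \<in> carrier G" for h
  proof -
    have yh: "y \<otimes> h = h \<otimes> y" and zh: "z \<otimes> h = h \<otimes> z"
      using y z h unfolding group_center_def by blast+
    have "y \<otimes> z \<otimes> h = y \<otimes> h \<otimes> z"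
      using yz h by (simp add: m_assoc zh)
    also have "\<dots> = h \<otimes> (y \<otimes> z)"
      using yz h unfolding yh by (simp add: m_assoc)
    finally show ?thesis .
  qed
  with yz show "y \<otimes> z \<in> group_center G"
    unfolding group_center_def by blast
qed

section \<open>Commutator calculus in a group with central derived subgroup\<close>

locale nil2 = group H for H (structure) +
  assumes derived_subset_center: "derived H (carrier H) \<subseteq> group_center H"
begin

abbreviation Z where "Z \<equiv> group_center H"
abbreviation D where "D \<equiv> derived H (carrier H)"
abbreviation com where "com \<equiv> commutator H"

lemma Z_closed [simp]: "z \<in> Z \<Longrightarrow> z \<in> carrier H"
  by (simp add: group_center_def)

lemma Z_comm: "z \<in> Z \<Longrightarrow> h \<in> carrier H \<Longrightarrow> h \<otimes> z = z \<otimes> h"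
  unfolding group_center_def by (drule CollectD, drule conjunct2, drule (1) bspec) (rule sym)

lemma Z_lcomm: "z \<in> Z \<Longrightarrow> h \<in> carrier H \<Longrightarrow> k \<in> carrier H \<Longrightarrow> h \<otimes> (z \<otimes> k) = z \<otimes> (h \<otimes> k)"
  by (metis Z_closed Z_comm m_assoc)

lemma inv_mult_cancel [simp]:
  "x \<in> carrier H \<Longrightarrow> y \<in> carrier H \<Longrightarrow> inv x \<otimes> (x \<otimes> y) = y"
  by (simp flip: m_assoc)

lemma mult_inv_cancel [simp]:
  "x \<in> carrier H \<Longrightarrow> y \<in> carrier H \<Longrightarrow> x \<otimes> (inv x \<otimes> y) = y"
  by (simp flip: m_assoc)

lemma Z_mult [simp]: "y \<in> Z \<Longrightarrow> z \<in> Z \<Longrightarrow> y \<otimes> z \<in> Z"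
  by (rule subgroup.m_closed[OF subgroup_group_center])

lemma Z_inv [simp]: "z \<in> Z \<Longrightarrow> inv z \<in> Z"
  by (rule subgroup.m_inv_closed[OF subgroup_group_center])

lemma Z_one [simp]: "\<one> \<in> Z"
  by (rule subgroup.one_closed[OF subgroup_group_center])

lemma D_subgroup: "subgroup D H"
  by (rule derived_is_subgroup) simp

lemma com_D [simp]:
  assumes "x \<in> carrier H" "y \<in> carrier H"
  shows "com x y \<in> D"
  using assms unfolding commutator_subgroup_carrier[symmetric] commutator_subgroup_def
  by (blast intro: generate.incl)

lemma com_Z [simp]: "x \<in> carrier H \<Longrightarrow> y \<in> carrier H \<Longrightarrow> com x y \<in> Z"
  using com_D derived_subset_center by blast

lemma com_inv_swap: "x \<in> carrier H \<Longrightarrow> y \<in> carrier H \<Longrightarrow> inv (com x y) = com y x"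
  by (simp add: commutator_def inv_mult_group m_assoc)

lemma mult_com: "x \<in> carrier H \<Longrightarrow> y \<in> carrier H \<Longrightarrow> y \<otimes> (x \<otimes> com x y) = x \<otimes> y"
  by (simp add: commutator_def m_assoc[symmetric])

text \<open>In any group \<open>com (x \<otimes> x') y\<close> is \<open>com x y\<close> conjugated
  by \<open>x'\<close>, times \<open>com x' y\<close>. Here \<open>com x y\<close> is central, so
  the conjugation disappears.\<close>

lemma com_mult_left:
  assumes "x \<in> carrier H" "x' \<in> carrier H" "y \<in> carrier H"
  shows "com (x \<otimes> x') y = com x y \<otimes> com x' y"
proof -
  have "com (x \<otimes> x') y = inv x' \<otimes> (com x y \<otimes> (inv y \<otimes> x' \<otimes> y))"
    using assms by (simp add: commutator_def inv_mult_group m_assoc)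
  also have "\<dots> = com x y \<otimes> (inv x' \<otimes> (inv y \<otimes> x' \<otimes> y))"
    using assms by (intro Z_lcomm) auto
  finally show ?thesis
    using assms by (simp add: commutator_def m_assoc)
qed

lemma com_mult_right:
  assumes "x \<in> carrier H" "y \<in> carrier H" "y' \<in> carrier H"
  shows "com x (y \<otimes> y') = com x y \<otimes> com x y'"
proof -
  \<comment> \<open>Inversion exchanges the two arguments of a commutator, so additivity on the
    right comes from additivity on the left. The factors appear in reversed order, which centrality
    repairs.\<close>
  have "com x (y \<otimes> y') = inv (com y x \<otimes> com y' x)"
    using assms by (simp add: com_inv_swap flip: com_mult_left)
  then show ?thesis
    using assms by (simp add: inv_mult_group com_inv_swap Z_comm[of "com x y" "com x y'"])
qed

lemma com_Z_left: "z \<in> Z \<Longrightarrow> y \<in> carrier H \<Longrightarrow> com z y = \<one>"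
  by (simp add: commutator_def m_assoc Z_lcomm[of z "inv y"])

lemma com_Z_right: "z \<in> Z \<Longrightarrow> x \<in> carrier H \<Longrightarrow> com x z = \<one>"
  using com_Z_left[of z x] com_inv_swap[of z x] by simp

text \<open>Additivity applied to \<open>inv x \<otimes> x\<close> gives
  \<open>com \<one> y\<close>, and this is trivial because \<open>\<one>\<close> is central.\<close>

lemma com_inv_left: "x \<in> carrier H \<Longrightarrow> y \<in> carrier H \<Longrightarrow> com (inv x) y = inv (com x y)"
  using com_mult_left[of "inv x" x y] by (intro inv_equality[symmetric]) (simp_all add: com_Z_left)

lemma com_inv_right: "x \<in> carrier H \<Longrightarrow> y \<in> carrier H \<Longrightarrow> com x (inv y) = inv (com x y)"
  using com_mult_right[of x "inv y" y] by (intro inv_equality[symmetric]) (simp_all add: com_Z_right)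

text \<open>Exchanging \<open>q\<close> and \<open>r\<close> costs the factor
  \<open>com q r\<close>, which is central and can be collected at the end with \<open>y\<close> and
  \<open>z\<close>. With \<open>p = f a\<close>, \<open>q = f b\<close>, \<open>r = g a\<close>,
  \<open>s = g b\<close> this is the computation behind the cross-effect of a pointwise
  product.\<close>

lemma mult_swap_middle:
  assumes "p \<in> carrier H" "q \<in> carrier H" "r \<in> carrier H" "s \<in> carrier H" "y \<in> Z" "z \<in> Z"
  shows "p \<otimes> q \<otimes> y \<otimes> (r \<otimes> s \<otimes> z) = p \<otimes> r \<otimes> (q \<otimes> s) \<otimes> (y \<otimes> z \<otimes> com q r)"
proof -
  \<comment> \<open>The trailing factor \<open>t\<close> allows the exchange to be applied inside a
    right-nested product.\<close>
  have swap: "q \<otimes> (r \<otimes> t) = r \<otimes> (q \<otimes> (com q r \<otimes> t))" if "t \<in> carrier H" for t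
  proof -
    have "q \<otimes> (r \<otimes> t) = r \<otimes> (q \<otimes> com q r) \<otimes> t"
      using assms that by (subst mult_com) (simp_all add: m_assoc)
    then show ?thesis
      using assms that by (simp add: m_assoc)
  qed
  \<comment> \<open>The flipped instances of \<open>Z_lcomm\<close> push the central
    \<open>y\<close> to the right, past \<open>r\<close> and \<open>s\<close>.\<close>
  have "p \<otimes> q \<otimes> y \<otimes> (r \<otimes> s \<otimes> z) = p \<otimes> (q \<otimes> (r \<otimes> (s \<otimes> (y \<otimes> z))))"
    using assms by (simp add: m_assoc flip: Z_lcomm[of y r] Z_lcomm[of y s])
  also have "\<dots> = p \<otimes> (r \<otimes> (q \<otimes> (com q r \<otimes> (s \<otimes> (y \<otimes> z)))))"
    using assms by (simp add: swap)
  also have "com q r \<otimes> (s \<otimes> (y \<otimes> z)) = s \<otimes> (y \<otimes> z \<otimes> com q r)"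
    using assms Z_lcomm[of "com q r" s "y \<otimes> z"] Z_comm[of "com q r" "y \<otimes> z"] by simp
  finally show ?thesis
    using assms by (simp add: m_assoc)
qed

lemma com_inv_inv: "x \<in> carrier H \<Longrightarrow> y \<in> carrier H \<Longrightarrow> com (inv x) (inv y) = com x y"
  by (simp add: com_inv_left com_inv_right)

end

section \<open>Maps with a central bilinear cross-effect\<close>

locale nil2_target = G: group G + nil2 H for G (structure) and H (structure)
begin

text \<open>The cross-effect is a separate argument \<open>c\<close>, tied to \<open>f\<close> by a
  product formula without inverses. An explicit candidate for a composite map can then be checked by
  direct expansion. On \<open>carrier G\<close> the formula determines \<open>c\<close>.\<close>

definition has_cross_effect :: "('a \<Rightarrow> 'c) \<Rightarrow> ('a \<Rightarrow> 'a \<Rightarrow> 'c) \<Rightarrow> bool"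
  where "has_cross_effect f c \<longleftrightarrow>
    (\<forall>a \<in> carrier G. f a \<in> carrier H) \<and>
    (\<forall>a \<in> carrier G. \<forall>b \<in> carrier G. c a b \<in> Z \<and> f (a \<otimes>\<^bsub>G\<^esub> b) = f a \<otimes>\<^bsub>H\<^esub> f b \<otimes>\<^bsub>H\<^esub> c a b) \<and>
    (\<forall>a \<in> carrier G. \<forall>a' \<in> carrier G. \<forall>b \<in> carrier G.
       c (a \<otimes>\<^bsub>G\<^esub> a') b = c a b \<otimes>\<^bsub>H\<^esub> c a' b \<and> c b (a \<otimes>\<^bsub>G\<^esub> a') = c b a \<otimes>\<^bsub>H\<^esub> c b a')"

lemma has_cross_effectD:
  assumes "has_cross_effect f c"
  shows "a \<in> carrier G \<Longrightarrow> f a \<in> carrier H"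
    and "a \<in> carrier G \<Longrightarrow> b \<in> carrier G \<Longrightarrow> c a b \<in> Z"
    and "a \<in> carrier G \<Longrightarrow> b \<in> carrier G \<Longrightarrow> f (a \<otimes>\<^bsub>G\<^esub> b) = f a \<otimes>\<^bsub>H\<^esub> f b \<otimes>\<^bsub>H\<^esub> c a b"
    and "a \<in> carrier G \<Longrightarrow> a' \<in> carrier G \<Longrightarrow> b \<in> carrier G \<Longrightarrow>
      c (a \<otimes>\<^bsub>G\<^esub> a') b = c a b \<otimes>\<^bsub>H\<^esub> c a' b"
    and "a \<in> carrier G \<Longrightarrow> a' \<in> carrier G \<Longrightarrow> b \<in> carrier G \<Longrightarrow>
      c b (a \<otimes>\<^bsub>G\<^esub> a') = c b a \<otimes>\<^bsub>H\<^esub> c b a'"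
  using assms unfolding has_cross_effect_def by blast+

lemma has_cross_effect_cong:
  assumes "\<And>a. a \<in> carrier G \<Longrightarrow> f a = g a" "has_cross_effect f c"
  shows "has_cross_effect g c"
  using assms by (simp add: has_cross_effect_def)

lemma cross_effect_eq:
  assumes "has_cross_effect f c" "a \<in> carrier G" "b \<in> carrier G"
  shows "cross_effect G H f a b = c a b"
  using assms by (simp add: cross_effect_def has_cross_effectD inv_mult_group m_assoc)

text \<open>Forwards, \<open>cross_effect G H f\<close> itself is the witness. Backwards, centrality
  of the values of \<open>c\<close> yields the commutation with values of \<open>f\<close> that weak
  quadraticity demands.\<close>

lemma quadratic_iff: "quadratic G H f \<longleftrightarrow> (\<exists>c. has_cross_effect f c)"
proof
  assume f: "quadratic G H f"
  then have "f a \<otimes>\<^bsub>H\<^esub> f b \<otimes>\<^bsub>H\<^esub> cross_effect G H f a b = f (a \<otimes>\<^bsub>G\<^esub> b)"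
    if "a \<in> carrier G" "b \<in> carrier G" for a b
  proof -
    have "f a \<in> carrier H" "f b \<in> carrier H" "f (a \<otimes>\<^bsub>G\<^esub> b) \<in> carrier H"
      using f that by (auto simp: quadratic_def weakly_quadratic_def)
    then show ?thesis
      by (simp add: cross_effect_def flip: m_assoc)
  qed
  then have "has_cross_effect f (cross_effect G H f)"
    using f by (auto simp: quadratic_def weakly_quadratic_def has_cross_effect_def hom_def)
  then show "\<exists>c. has_cross_effect f c"
    by blast
next
  assume "\<exists>c. has_cross_effect f c"
  then obtain c where c: "has_cross_effect f c"
    by blast
  then show "quadratic G H f"
    by (auto simp: quadratic_def weakly_quadratic_def hom_def cross_effect_eq[OF c]
        has_cross_effectD[OF c] intro: Z_comm[symmetric])
qed

text \<open>Since \<open>D\<close> lies in \<open>Z\<close>, a q-map is a quadratic map whose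
  cross-effect takes values in \<open>D\<close>.\<close>

lemma q_map_iff:
  "q_map G H f \<longleftrightarrow>
    (\<exists>c. has_cross_effect f c \<and> (\<forall>a \<in> carrier G. \<forall>b \<in> carrier G. c a b \<in> D))"
proof -
  have "q_map G H f \<longleftrightarrow> quadratic G H f \<and>
      (\<forall>a \<in> carrier G. \<forall>b \<in> carrier G. cross_effect G H f a b \<in> D)"
    using derived_subset_center by (auto simp: q_map_def quadratic_def)
  also have "\<dots> \<longleftrightarrow>
      (\<exists>c. has_cross_effect f c \<and> (\<forall>a \<in> carrier G. \<forall>b \<in> carrier G. c a b \<in> D))"
    by (auto simp: quadratic_iff cross_effect_eq)
  finally show ?thesis .
qed

text \<open>The extra term arises from moving \<open>f b\<close> past \<open>g a\<close>. It is
  additive in \<open>a\<close> and in \<open>b\<close> because \<open>g\<close> and \<open>f\<close>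
  are additive up to central factors, on which commutators vanish.\<close>

lemma has_cross_effect_mult:
  assumes f: "has_cross_effect f c" and g: "has_cross_effect g d"
  shows "has_cross_effect (\<lambda>x. f x \<otimes>\<^bsub>H\<^esub> g x)
    (\<lambda>a b. c a b \<otimes>\<^bsub>H\<^esub> d a b \<otimes>\<^bsub>H\<^esub> com (f b) (g a))"
proof -
  note fD = has_cross_effectD[OF f] and gD = has_cross_effectD[OF g]
  have cross: "f (a \<otimes>\<^bsub>G\<^esub> b) \<otimes>\<^bsub>H\<^esub> g (a \<otimes>\<^bsub>G\<^esub> b) =
      f a \<otimes>\<^bsub>H\<^esub> g a \<otimes>\<^bsub>H\<^esub> (f b \<otimes>\<^bsub>H\<^esub> g b) \<otimes>\<^bsub>H\<^esub>
        (c a b \<otimes>\<^bsub>H\<^esub> d a b \<otimes>\<^bsub>H\<^esub> com (f b) (g a))"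
    if ab: "a \<in> carrier G" "b \<in> carrier G" for a b
  using that by (simp add: fD gD mult_swap_middle)
  \<comment> \<open>Additivity of the three terms gives pairs of central factors; this regroups them
    by the arguments \<open>a\<close> and \<open>a'\<close>.\<close>
  have swap: "(p \<otimes>\<^bsub>H\<^esub> p') \<otimes>\<^bsub>H\<^esub> (q \<otimes>\<^bsub>H\<^esub> q') \<otimes>\<^bsub>H\<^esub> (r \<otimes>\<^bsub>H\<^esub> r') =
      (p \<otimes>\<^bsub>H\<^esub> q \<otimes>\<^bsub>H\<^esub> r) \<otimes>\<^bsub>H\<^esub> (p' \<otimes>\<^bsub>H\<^esub> q' \<otimes>\<^bsub>H\<^esub> r')"
    if "p \<in> Z" "p' \<in> Z" "q \<in> Z" "q' \<in> Z" "r \<in> Z" "r' \<in> Z" for p p' q q' r r'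
    using that by (simp add: m_assoc Z_lcomm[of q p'] Z_lcomm[of r q'] Z_lcomm[of r p'])
  show ?thesis
    unfolding has_cross_effect_def
  proof (intro conjI ballI)
    fix a a' b assume abc: "a \<in> carrier G" "a' \<in> carrier G" "b \<in> carrier G"
    show "c (a \<otimes>\<^bsub>G\<^esub> a') b \<otimes>\<^bsub>H\<^esub> d (a \<otimes>\<^bsub>G\<^esub> a') b \<otimes>\<^bsub>H\<^esub> com (f b) (g (a \<otimes>\<^bsub>G\<^esub> a')) =
        c a b \<otimes>\<^bsub>H\<^esub> d a b \<otimes>\<^bsub>H\<^esub> com (f b) (g a) \<otimes>\<^bsub>H\<^esub>
        (c a' b \<otimes>\<^bsub>H\<^esub> d a' b \<otimes>\<^bsub>H\<^esub> com (f b) (g a'))"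
      using abc by (simp add: fD gD com_mult_right com_Z_right swap)
    show "c b (a \<otimes>\<^bsub>G\<^esub> a') \<otimes>\<^bsub>H\<^esub> d b (a \<otimes>\<^bsub>G\<^esub> a') \<otimes>\<^bsub>H\<^esub> com (f (a \<otimes>\<^bsub>G\<^esub> a')) (g b) =
        c b a \<otimes>\<^bsub>H\<^esub> d b a \<otimes>\<^bsub>H\<^esub> com (f a) (g b) \<otimes>\<^bsub>H\<^esub>
        (c b a' \<otimes>\<^bsub>H\<^esub> d b a' \<otimes>\<^bsub>H\<^esub> com (f a') (g b))"
      using abc by (simp add: fD gD com_mult_left com_Z_left swap)
  qed (use cross fD gD in simp_all)
qed

text \<open>Inversion reverses the product \<open>f a \<otimes> f b\<close>, and restoring the order
  produces the commutator term, which is bilinear for the same reason as for products.\<close>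

lemma has_cross_effect_inv:
  assumes f: "has_cross_effect f c"
  shows "has_cross_effect (\<lambda>x. inv\<^bsub>H\<^esub> f x) (\<lambda>a b. inv\<^bsub>H\<^esub> c a b \<otimes>\<^bsub>H\<^esub> com (f b) (f a))"
proof -
  note fD = has_cross_effectD[OF f]
  have cross: "inv\<^bsub>H\<^esub> f (a \<otimes>\<^bsub>G\<^esub> b) =
      inv\<^bsub>H\<^esub> f a \<otimes>\<^bsub>H\<^esub> inv\<^bsub>H\<^esub> f b \<otimes>\<^bsub>H\<^esub> (inv\<^bsub>H\<^esub> c a b \<otimes>\<^bsub>H\<^esub> com (f b) (f a))"
    if ab: "a \<in> carrier G" "b \<in> carrier G" for a b
  proof -
    have z: "inv\<^bsub>H\<^esub> c a b \<in> Z"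
      using ab by (simp add: fD)
    have "inv\<^bsub>H\<^esub> f (a \<otimes>\<^bsub>G\<^esub> b) = inv\<^bsub>H\<^esub> c a b \<otimes>\<^bsub>H\<^esub> (inv\<^bsub>H\<^esub> f b \<otimes>\<^bsub>H\<^esub> inv\<^bsub>H\<^esub> f a)"
      using ab by (simp add: fD inv_mult_group)
    \<comment> \<open>Reordering yields the commutator of the two inverses; by bilinearity the two
      signs cancel.\<close>
    also have "inv\<^bsub>H\<^esub> f b \<otimes>\<^bsub>H\<^esub> inv\<^bsub>H\<^esub> f a =
        inv\<^bsub>H\<^esub> f a \<otimes>\<^bsub>H\<^esub> (inv\<^bsub>H\<^esub> f b \<otimes>\<^bsub>H\<^esub> com (f b) (f a))"
      using ab mult_com[of "inv\<^bsub>H\<^esub> f b" "inv\<^bsub>H\<^esub> f a"] by (simp add: fD com_inv_inv)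
    finally show ?thesis
      using ab by (simp add: fD m_assoc Z_lcomm[OF z])
  qed
  have swap: "inv\<^bsub>H\<^esub> (p \<otimes>\<^bsub>H\<^esub> p') \<otimes>\<^bsub>H\<^esub> (r \<otimes>\<^bsub>H\<^esub> r') =
      inv\<^bsub>H\<^esub> p \<otimes>\<^bsub>H\<^esub> r \<otimes>\<^bsub>H\<^esub> (inv\<^bsub>H\<^esub> p' \<otimes>\<^bsub>H\<^esub> r')"
    if "p \<in> Z" "p' \<in> Z" "r \<in> Z" "r' \<in> Z" for p p' r r'
    using that by (simp add: m_assoc inv_mult_group Z_lcomm[of "inv\<^bsub>H\<^esub> p" "inv\<^bsub>H\<^esub> p'"] Z_lcomm[of r "inv\<^bsub>H\<^esub> p'"])
  show ?thesis
    unfolding has_cross_effect_def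
  proof (intro conjI ballI)
    fix a a' b assume abc: "a \<in> carrier G" "a' \<in> carrier G" "b \<in> carrier G"
    show "inv\<^bsub>H\<^esub> c (a \<otimes>\<^bsub>G\<^esub> a') b \<otimes>\<^bsub>H\<^esub> com (f b) (f (a \<otimes>\<^bsub>G\<^esub> a')) =
        inv\<^bsub>H\<^esub> c a b \<otimes>\<^bsub>H\<^esub> com (f b) (f a) \<otimes>\<^bsub>H\<^esub> (inv\<^bsub>H\<^esub> c a' b \<otimes>\<^bsub>H\<^esub> com (f b) (f a'))"
      using abc by (simp add: fD com_mult_right com_Z_right swap)
    show "inv\<^bsub>H\<^esub> c b (a \<otimes>\<^bsub>G\<^esub> a') \<otimes>\<^bsub>H\<^esub> com (f (a \<otimes>\<^bsub>G\<^esub> a')) (f b) =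
        inv\<^bsub>H\<^esub> c b a \<otimes>\<^bsub>H\<^esub> com (f a) (f b) \<otimes>\<^bsub>H\<^esub> (inv\<^bsub>H\<^esub> c b a' \<otimes>\<^bsub>H\<^esub> com (f a') (f b))"
      using abc by (simp add: fD com_mult_left com_Z_left swap)
  qed (use cross fD in simp_all)
qed

section \<open>Closure properties of quadratic maps and q-maps\<close>

lemma quadratic_cong:
  "(\<And>a. a \<in> carrier G \<Longrightarrow> f a = g a) \<Longrightarrow> quadratic G H f \<Longrightarrow> quadratic G H g"
  unfolding quadratic_iff using has_cross_effect_cong by blast

lemma q_map_cong:
  "(\<And>a. a \<in> carrier G \<Longrightarrow> f a = g a) \<Longrightarrow> q_map G H f \<Longrightarrow> q_map G H g"
  unfolding q_map_iff using has_cross_effect_cong by blast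

lemma quadratic_mult:
  "quadratic G H f \<Longrightarrow> quadratic G H g \<Longrightarrow> quadratic G H (\<lambda>x. f x \<otimes>\<^bsub>H\<^esub> g x)"
  unfolding quadratic_iff using has_cross_effect_mult by blast

lemma quadratic_inv: "quadratic G H f \<Longrightarrow> quadratic G H (\<lambda>x. inv\<^bsub>H\<^esub> f x)"
  unfolding quadratic_iff using has_cross_effect_inv by blast

lemma q_map_imp_quadratic: "q_map G H f \<Longrightarrow> quadratic G H f"
  unfolding quadratic_iff q_map_iff by blast

lemma q_map_mult:
  assumes "q_map G H f" "q_map G H g"
  shows "q_map G H (\<lambda>x. f x \<otimes>\<^bsub>H\<^esub> g x)"
proof -
  obtain c d where c: "has_cross_effect f c" "\<forall>a \<in> carrier G. \<forall>b \<in> carrier G. c a b \<in> D"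
    and d: "has_cross_effect g d" "\<forall>a \<in> carrier G. \<forall>b \<in> carrier G. d a b \<in> D"
    using assms unfolding q_map_iff by blast
  show ?thesis
    unfolding q_map_iff
    by (intro exI conjI, rule has_cross_effect_mult[OF c(1) d(1)])
      (use c d in \<open>simp add: has_cross_effectD(1) subgroup.m_closed[OF D_subgroup]\<close>)
qed

lemma q_map_inv:
  assumes "q_map G H f"
  shows "q_map G H (\<lambda>x. inv\<^bsub>H\<^esub> f x)"
proof -
  obtain c where c: "has_cross_effect f c" "\<forall>a \<in> carrier G. \<forall>b \<in> carrier G. c a b \<in> D"
    using assms unfolding q_map_iff by blast
  show ?thesis
    unfolding q_map_iff
    by (intro exI conjI, rule has_cross_effect_inv[OF c(1)])
      (use c in \<open>simp add: has_cross_effectD(1) subgroup.m_closed[OF D_subgroup]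
        subgroup.m_inv_closed[OF D_subgroup]\<close>)
qed

text \<open>The cross-effect \<open>d\<close> of \<open>g\<close> is central but may lie outside
  \<open>D\<close>. It enters once through \<open>g\<close> and once inverted through the inverse of
  \<open>g\<close>, so it cancels, leaving only \<open>c\<close> and commutators, all in
  \<open>D\<close>.\<close>

lemma q_map_conjugate:
  assumes "quadratic G H g" "q_map G H f"
  shows "q_map G H (\<lambda>x. g x \<otimes>\<^bsub>H\<^esub> f x \<otimes>\<^bsub>H\<^esub> inv\<^bsub>H\<^esub> g x)"
proof -
  obtain c d where c: "has_cross_effect f c" "\<forall>a \<in> carrier G. \<forall>b \<in> carrier G. c a b \<in> D"
    and d: "has_cross_effect g d"
    using assms unfolding q_map_iff quadratic_iff by blast
  note DD = subgroup.m_closed[OF D_subgroup]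
  \<comment> \<open>Here \<open>z\<close> stands for \<open>d a b\<close>, \<open>x\<close> for
    \<open>c a b\<close>, and \<open>u\<close>, \<open>v\<close>, \<open>w\<close> for the
    commutators from the first product, the inversion and the second product.\<close>
  have cancel: "z \<otimes>\<^bsub>H\<^esub> x \<otimes>\<^bsub>H\<^esub> u \<otimes>\<^bsub>H\<^esub> (inv\<^bsub>H\<^esub> z \<otimes>\<^bsub>H\<^esub> v) \<otimes>\<^bsub>H\<^esub> w \<in> D"
    if "z \<in> Z" "x \<in> D" "u \<in> D" "v \<in> D" "w \<in> D" for z x u v w
  proof -
    have xuv: "x \<in> carrier H" "u \<in> carrier H" "v \<in> carrier H"
      using that subgroup.subset[OF D_subgroup] by blast+
    have "z \<otimes>\<^bsub>H\<^esub> x \<otimes>\<^bsub>H\<^esub> u \<otimes>\<^bsub>H\<^esub> (inv\<^bsub>H\<^esub> z \<otimes>\<^bsub>H\<^esub> v) = x \<otimes>\<^bsub>H\<^esub> u \<otimes>\<^bsub>H\<^esub> v"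
      using that(1) xuv by (simp add: m_assoc Z_lcomm[of "inv\<^bsub>H\<^esub> z" u] Z_lcomm[of "inv\<^bsub>H\<^esub> z" x])
    then show ?thesis
      using that DD by simp
  qed
  show ?thesis
    unfolding q_map_iff
    by (intro exI conjI,
        rule has_cross_effect_mult[OF has_cross_effect_mult[OF d c(1)] has_cross_effect_inv[OF d]])
      (use c d in \<open>simp add: has_cross_effectD(1,2) cancel\<close>)
qed

section \<open>Homomorphisms and their integer linear combinations\<close>

lemma hom_imp_q_map:
  assumes "f \<in> hom G H"
  shows "q_map G H f"
  unfolding q_map_iff
proof (intro exI conjI)
  show "has_cross_effect f (\<lambda>a b. \<one>\<^bsub>H\<^esub>)"
    using assms by (auto simp: has_cross_effect_def hom_def Pi_def)
qed (simp add: subgroup.one_closed[OF D_subgroup])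

lemma q_map_one: "q_map G H (\<lambda>x. \<one>\<^bsub>H\<^esub>)"
  by (rule hom_imp_q_map) (simp add: hom_def)

lemma q_map_nat_pow:
  assumes "q_map G H f"
  shows "q_map G H (\<lambda>x. f x [^]\<^bsub>H\<^esub> (n :: nat))"
proof (induction n)
  case (Suc n)
  then show ?case
    using q_map_mult[OF Suc assms] by simp
qed (simp add: q_map_one)

lemma q_map_int_pow:
  assumes "q_map G H f"
  shows "q_map G H (\<lambda>x. f x [^]\<^bsub>H\<^esub> (n :: int))"
proof (cases "n < 0")
  case True
  \<comment> \<open>The sign of \<open>n\<close> does not depend on \<open>x\<close>, so the case
    distinction in the integer power can be made once for the whole map.\<close>
  then have "(\<lambda>x. f x [^]\<^bsub>H\<^esub> n) = (\<lambda>x. inv\<^bsub>H\<^esub> (f x [^]\<^bsub>H\<^esub> nat (- n)))"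
    unfolding int_pow_def2 by presburger
  then show ?thesis
    using q_map_inv[OF q_map_nat_pow[OF assms]] by presburger
next
  case False
  then have "(\<lambda>x. f x [^]\<^bsub>H\<^esub> n) = (\<lambda>x. f x [^]\<^bsub>H\<^esub> nat n)"
    unfolding int_pow_def2 by presburger
  then show ?thesis
    using q_map_nat_pow[OF assms] by presburger
qed

lemma q_map_foldr:
  assumes "\<forall>(n, f) \<in> set nfs. q_map G H f"
  shows "q_map G H (\<lambda>x. foldr (\<lambda>(n :: int, f) s. f x [^]\<^bsub>H\<^esub> n \<otimes>\<^bsub>H\<^esub> s) nfs \<one>\<^bsub>H\<^esub>)"
  using assms
  by (induction nfs) (auto simp: q_map_one intro: q_map_mult q_map_int_pow)

section \<open>The group of quadratic maps and its subgroup of q-maps\<close>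

lemma q_map_closed: "q_map G H f \<Longrightarrow> x \<in> carrier G \<Longrightarrow> f x \<in> carrier H"
  by (auto simp: q_map_def weakly_quadratic_def)

lemma quadratic_closed: "quadratic G H f \<Longrightarrow> x \<in> carrier G \<Longrightarrow> f x \<in> carrier H"
  by (auto simp: quadratic_def weakly_quadratic_def)

text \<open>Being a q-map depends only on the values on \<open>carrier G\<close>, so the closure
  properties pass to the representatives that are \<open>undefined\<close> elsewhere.\<close>

lemma restrict_in_Q_maps:
  assumes "q_map G H f"
  shows "restrict f (carrier G) \<in> Q_maps G H"
  using assms q_map_cong[of f "restrict f (carrier G)"]
  by (simp add: Q_maps_def q_map_closed)

lemma restrict_in_Quad:
  assumes "quadratic G H f"
  shows "restrict f (carrier G) \<in> carrier (Quad G H)"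
  using assms quadratic_cong[of f "restrict f (carrier G)"]
  by (simp add: Quad_def quadratic_closed)

lemma Quad_quadratic: "f \<in> carrier (Quad G H) \<Longrightarrow> quadratic G H f"
  by (simp add: Quad_def)

lemma Quad_closed: "f \<in> carrier (Quad G H) \<Longrightarrow> x \<in> carrier G \<Longrightarrow> f x \<in> carrier H"
  by (simp add: Quad_quadratic quadratic_closed)

lemma Quad_extensional: "f \<in> carrier (Quad G H) \<Longrightarrow> f \<in> extensional (carrier G)"
  by (auto simp: Quad_def PiE_def)

lemma Quad_mult: "f \<otimes>\<^bsub>Quad G H\<^esub> g = (\<lambda>x \<in> carrier G. f x \<otimes>\<^bsub>H\<^esub> g x)"
  by (simp add: Quad_def)

lemma Quad_one: "\<one>\<^bsub>Quad G H\<^esub> = (\<lambda>x \<in> carrier G. \<one>\<^bsub>H\<^esub>)"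
  by (simp add: Quad_def)

lemma Quad_left_inv:
  assumes "f \<in> carrier (Quad G H)"
  shows "(\<lambda>x \<in> carrier G. inv\<^bsub>H\<^esub> f x) \<otimes>\<^bsub>Quad G H\<^esub> f = \<one>\<^bsub>Quad G H\<^esub>"
  using assms by (auto simp: Quad_mult Quad_one Quad_closed intro: restrict_ext)

lemma Quad_inv_closed:
  "f \<in> carrier (Quad G H) \<Longrightarrow> (\<lambda>x \<in> carrier G. inv\<^bsub>H\<^esub> f x) \<in> carrier (Quad G H)"
  by (intro restrict_in_Quad quadratic_inv Quad_quadratic)

lemma group_Quad: "group (Quad G H)"
proof (rule groupI)
  fix f g assume "f \<in> carrier (Quad G H)" "g \<in> carrier (Quad G H)"
  then show "f \<otimes>\<^bsub>Quad G H\<^esub> g \<in> carrier (Quad G H)"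
    unfolding Quad_mult by (intro restrict_in_Quad quadratic_mult Quad_quadratic)
next
  show "\<one>\<^bsub>Quad G H\<^esub> \<in> carrier (Quad G H)"
    unfolding Quad_one by (intro restrict_in_Quad q_map_imp_quadratic q_map_one)
next
  fix f g h
  assume "f \<in> carrier (Quad G H)" "g \<in> carrier (Quad G H)" "h \<in> carrier (Quad G H)"
  then show "f \<otimes>\<^bsub>Quad G H\<^esub> g \<otimes>\<^bsub>Quad G H\<^esub> h = f \<otimes>\<^bsub>Quad G H\<^esub> (g \<otimes>\<^bsub>Quad G H\<^esub> h)"
    by (auto simp: Quad_mult Quad_closed m_assoc intro: restrict_ext)
next
  fix f assume f: "f \<in> carrier (Quad G H)"
  then show "\<one>\<^bsub>Quad G H\<^esub> \<otimes>\<^bsub>Quad G H\<^esub> f = f"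
    \<comment> \<open>The product is a restricted function, so equality with \<open>f\<close> also
      uses that \<open>f\<close> is \<open>undefined\<close> outside
      \<open>carrier G\<close>.\<close>
    by (intro extensionalityI[of _ "carrier G"])
      (simp_all add: Quad_mult Quad_one Quad_closed Quad_extensional)
  show "\<exists>g \<in> carrier (Quad G H). g \<otimes>\<^bsub>Quad G H\<^esub> f = \<one>\<^bsub>Quad G H\<^esub>"
    using Quad_left_inv[OF f] Quad_inv_closed[OF f] by blast
qed

text \<open>The pointwise inverse is a left inverse inside the carrier, and left inverses in a group
  are unique.\<close>

lemma Quad_inv:
  assumes "f \<in> carrier (Quad G H)"
  shows "inv\<^bsub>Quad G H\<^esub> f = (\<lambda>x \<in> carrier G. inv\<^bsub>H\<^esub> f x)"
  using group.inv_equality[OF group_Quad Quad_left_inv[OF assms] assms Quad_inv_closed[OF assms]] .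

lemma Q_maps_normal: "Q_maps G H \<lhd> Quad G H"
proof -
  have sub: "Q_maps G H \<subseteq> carrier (Quad G H)"
    by (auto simp: Q_maps_def Quad_def q_map_imp_quadratic)
  have q: "q_map G H f" if "f \<in> Q_maps G H" for f
    using that by (simp add: Q_maps_def)
  have "subgroup (Q_maps G H) (Quad G H)"
  proof (rule group.subgroupI[OF group_Quad sub])
    show "Q_maps G H \<noteq> {}"
      using restrict_in_Q_maps[OF q_map_one] by blast
  next
    fix f assume "f \<in> Q_maps G H"
    then show "inv\<^bsub>Quad G H\<^esub> f \<in> Q_maps G H"
      using subsetD[OF sub] by (simp add: Quad_inv restrict_in_Q_maps q_map_inv q)
  next
    fix f g assume "f \<in> Q_maps G H" "g \<in> Q_maps G H"
    then show "f \<otimes>\<^bsub>Quad G H\<^esub> g \<in> Q_maps G H"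
      by (auto simp: Quad_mult intro: restrict_in_Q_maps q_map_mult q)
  qed
  moreover have "g \<otimes>\<^bsub>Quad G H\<^esub> f \<otimes>\<^bsub>Quad G H\<^esub> inv\<^bsub>Quad G H\<^esub> g \<in> Q_maps G H"
    if g: "g \<in> carrier (Quad G H)" and f: "f \<in> Q_maps G H" for f g
  proof -
    \<comment> \<open>Conjugation in \<open>Quad G H\<close> is computed pointwise, which reduces
      normality to \<open>q_map_conjugate\<close>.\<close>
    have "g \<otimes>\<^bsub>Quad G H\<^esub> f \<otimes>\<^bsub>Quad G H\<^esub> inv\<^bsub>Quad G H\<^esub> g =
        (\<lambda>x \<in> carrier G. g x \<otimes>\<^bsub>H\<^esub> f x \<otimes>\<^bsub>H\<^esub> inv\<^bsub>H\<^esub> g x)"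
      using g by (auto simp: Quad_mult Quad_inv intro: restrict_ext)
    then show ?thesis
      using restrict_in_Q_maps[OF q_map_conjugate[OF Quad_quadratic[OF g] q[OF f]]] by simp
  qed
  ultimately show ?thesis
    using group.normal_inv_iff[OF group_Quad] by blast
qed

lemma linear_combination_in_Q_maps:
  assumes "\<forall>(n, f) \<in> set nfs. f \<in> hom G H"
  shows "linear_combination G H nfs \<in> Q_maps G H"
  unfolding linear_combination_def
  by (intro restrict_in_Q_maps q_map_foldr) (use assms hom_imp_q_map in blast)

end

theorem lemma3p2:
  fixes G :: "('a, 'm) monoid_scheme" and H :: "('b, 'n) monoid_scheme"
  assumes "nil2_group G" and "nil2_group H"
  shows "Q_maps G H \<lhd> Quad G H \<and>
    (\<forall>nfs :: (int \<times> ('a \<Rightarrow> 'b)) list.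
       (\<forall>(n, f) \<in> set nfs. f \<in> hom G H) \<longrightarrow> linear_combination G H nfs \<in> Q_maps G H)"
proof -
  \<comment> \<open>The class-two hypothesis on \<open>H\<close> enters as the inclusion of its
    derived subgroup in its center.\<close>
  interpret nil2_target G H
    using assms by (simp add: nil2_target_def nil2_def nil2_axioms_def
        nil2_group_derived_subset_center nil2_group_def)
  show ?thesis
    using Q_maps_normal linear_combination_in_Q_maps by blast
qed

end
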